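(* Let $(X,\|\cdot\|)$ be a real normed vector space which has a convex corner. Then $\Upsilon(X,\|\cdot\|)=(-1,1)$.
   Context: A vector $\widehat y\in X$ is called a convex corner of $(X,\|\cdot\|)$ if there are a vector $\overline x\in X$ and real numbers $m_-<m_+$ such that for each $\delta\in[0,1]$ $$\|\delta\cdot\overline x+(1+\delta\cdot m_-)\cdot\widehat y\|=1=\|-\delta\cdot\overline x+(1-\delta\cdot m_+)\cdot\widehat y\|.$$ Let $\varrho\in\mathbb{R}$. For $\vec x,\vec y\in X\setminus\{\vec 0\}$ put $\mathbf{s}=\left\|\frac{\vec x}{\|\vec x\|}+\frac{\vec y}{\|\vec y\|}\right\|$, $\mathbf{d}=\left\|\frac{\vec x}{\|\vec x\|}-\frac{\vec y}{\|\vec y\|}\right\|$, $\mathbf{\Sigma}=\mathbf{s}^2+\mathbf{d}^2$ (which is $>0$), $\mathbf{\Delta}=\mathbf{s}^2-\mathbf{d}^2$, and $\langle\vec x\,|\,\vec y\rangle_\varrho=\|\vec x\|\cdot\|\vec y\|\cdot\frac14\mathbf{\Delta}\cdot\left(\frac14\mathbf{\Sigma}\right)^{\varrho}$; put $\langle\vec x\,|\,\vec y\rangle_\varrho=0$ if $\vec x=\vec 0$ or $\vec y=\vec 0$. The space "has the angle $\angle_\varrho$" if $|\langle\vec x\,|\,\vec y\rangle_\varrho|\le\|\vec x\|\cdot\|\vec y\|$ for all $\vec x,\vec y\in X$. $\Upsilon(X,\|\cdot\|):=(\nu,\mu)$, where $\nu:=\inf\{\kappa\in\mathbb{R}\mid(X,\|\cdot\|)\text{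 has the angle }\angle_\kappa\}$ and $\mu:=\sup\{\kappa\in\mathbb{R}\mid(X,\|\cdot\|)\text{ has the angle }\angle_\kappa\}$ in the extended reals (here $(\nu,\mu)$ denotes an ordered pair). *)

theory Defs
  imports Complex_Main "HOL-Library.Extended_Real"
begin

definition convex_corner :: "'a::real_normed_vector \<Rightarrow> bool" where
  "convex_corner y \<longleftrightarrow>
    (\<exists>(x::'a) (m_minus::real) (m_plus::real). m_minus < m_plus \<and>
      (\<forall>\<delta>\<in>{0..1}.
        norm (\<delta> *\<^sub>R x + (1 + \<delta> * m_minus) *\<^sub>R y) = 1 \<and>
        norm (- \<delta> *\<^sub>R x + (1 - \<delta> * m_plus) *\<^sub>R y) = 1))"

definition s_sum :: "'a::real_normed_vector \<Rightarrow> 'a \<Rightarrow> real" where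
  "s_sum x y = norm (x /\<^sub>R norm x + y /\<^sub>R norm y)"

definition d_diff :: "'a::real_normed_vector \<Rightarrow> 'a \<Rightarrow> real" where
  "d_diff x y = norm (x /\<^sub>R norm x - y /\<^sub>R norm y)"

definition Sigma_sd :: "'a::real_normed_vector \<Rightarrow> 'a \<Rightarrow> real" where
  "Sigma_sd x y = (s_sum x y)\<^sup>2 + (d_diff x y)\<^sup>2"

definition Delta_sd :: "'a::real_normed_vector \<Rightarrow> 'a \<Rightarrow> real" where
  "Delta_sd x y = (s_sum x y)\<^sup>2 - (d_diff x y)\<^sup>2"

text \<open>For nonzero arguments \<open>Sigma_sd x y\<close> is positive, so \<open>powr\<close> is the
  ordinary real power below.\<close>

definition rho_product :: "real \<Rightarrow> 'a::real_normed_vector \<Rightarrow> 'a \<Rightarrow> real" where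
  "rho_product \<rho> x y =
    (if x = 0 \<or> y = 0 then 0
     else norm x * norm y * (1/4 * Delta_sd x y) * (1/4 * Sigma_sd x y) powr \<rho>)"

text \<open>The properties below concern the whole space, which is the universe of a type of class
  \<open>real_normed_vector\<close>; it is passed as a type token.\<close>

definition has_angle :: "'a::real_normed_vector itself \<Rightarrow> real \<Rightarrow> bool" where
  "has_angle X \<rho> \<longleftrightarrow> (\<forall>x y :: 'a. \<bar>rho_product \<rho> x y\<bar> \<le> norm x * norm y)"

definition Upsilon :: "'a::real_normed_vector itself \<Rightarrow> ereal \<times> ereal" where
  "Upsilon X =
    (Inf (ereal ` {\<kappa>. has_angle X \<kappa>}), Sup (ereal ` {\<kappa>. has_angle X \<kappa>}))"

end

theory Submission imports Defs begin

text \<open>The proof shows that, in a space with a convex corner, the angle \<open>\<rho>\<close> exists exactly for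
  \<open>\<rho> \<in> {-1..1}\<close>.

  Sufficiency holds in every normed space. Write \<open>a = s\<^sup>2/4\<close> and \<open>b = d\<^sup>2/4\<close>; both lie in \<open>[0,1]\<close>, and
  the condition reads \<open>\<bar>a - b\<bar> (a + b)\<^sup>\<rho> \<le> 1\<close>. The left-hand side is increasing in \<open>\<rho>\<close> if
  \<open>a + b \<ge> 1\<close> and decreasing otherwise, so for \<open>\<rho> \<in> {-1..1}\<close> it is bounded by its value
  \<open>\<bar>a\<^sup>2 - b\<^sup>2\<bar> \<le> 1\<close> at \<open>\<rho> = 1\<close> in the former case, and by its value
  \<open>\<bar>a - b\<bar> / (a + b) \<le> 1\<close> at \<open>\<rho> = -1\<close> in the latter.

  Necessity uses the two segments of unit vectors that meet in the corner \<open>y\<close>.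

  Two unit vectors on the same segment have \<open>a = 1\<close> and arbitrarily small \<open>b > 0\<close>. As
  \<open>(1 - b) (1 + b)\<^sup>\<rho> = 1 + (\<rho> - 1) b + o(b)\<close>, this excludes \<open>\<rho> > 1\<close>.

  Two unit vectors at parameter \<open>\<delta>\<close> on the two different segments have a sum that is the
  multiple \<open>2 - \<delta> m\<close> of \<open>y\<close>, with \<open>m > 0\<close> measuring the sharpness of the corner, while their difference
  is proportional to \<open>\<delta>\<close>. Thus \<open>a = 1 - \<delta> m + o(\<delta>)\<close> and \<open>b = o(\<delta>)\<close>, so the left-hand
  side is \<open>1 - (1 + \<rho>) m \<delta> + o(\<delta>)\<close>, and this excludes \<open>\<rho> < -1\<close>.\<close>

lemma abs_diff_times_powr_le_one:
  fixes a b \<rho> :: real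
  assumes "0 \<le> a" "a \<le> 1" "0 \<le> b" "b \<le> 1" "-1 \<le> \<rho>" "\<rho> \<le> 1"
  shows "\<bar>a - b\<bar> * (a + b) powr \<rho> \<le> 1"
proof (cases "a + b \<ge> 1")
  case True
  have "\<bar>a - b\<bar> * (a + b) powr \<rho> \<le> \<bar>a - b\<bar> * (a + b) powr 1"
    using True assms by (intro mult_left_mono powr_mono) auto
  also have "\<dots> = \<bar>a\<^sup>2 - b\<^sup>2\<bar>"
    using assms by (simp add: power2_eq_square square_diff_square_factored abs_mult mult.commute)
  also have "\<dots> \<le> 1"
    using assms power_le_one[of a 2] power_le_one[of b 2]
      zero_le_power2[of a] zero_le_power2[of b] by linarith
  finally show ?thesis .
next
  case False
  show ?thesis
  proof (cases "a + b = 0")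
    case False
    with assms have pos: "a + b > 0" by linarith
    have "\<bar>a - b\<bar> * (a + b) powr \<rho> \<le> \<bar>a - b\<bar> * (a + b) powr (-1)"
      using \<open>\<not> a + b \<ge> 1\<close> pos assms by (intro mult_left_mono powr_mono') auto
    also have "\<dots> = \<bar>a - b\<bar> / (a + b)"
      using pos by (simp add: powr_minus divide_inverse)
    also have "\<dots> \<le> 1"
      using pos assms by (simp add: abs_le_iff)
    finally show ?thesis .
  qed auto
qed

lemma quarter_norm_sum_squared_le_one:
  fixes u v :: "'a::real_normed_vector"
  assumes "norm u = 1" "norm v = 1"
  shows "(norm (u + v))\<^sup>2 / 4 \<le> 1" "(norm (u - v))\<^sup>2 / 4 \<le> 1"
  using power_mono[of "norm (u + v)" 2 2] power_mono[of "norm (u - v)" 2 2]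
    norm_triangle_ineq[of u v] norm_triangle_ineq4[of u v] assms by auto

lemma rho_product_unit:
  fixes u v :: "'a::real_normed_vector"
  assumes "norm u = 1" "norm v = 1"
  shows "rho_product \<rho> u v =
    ((norm (u + v))\<^sup>2 / 4 - (norm (u - v))\<^sup>2 / 4) *
    ((norm (u + v))\<^sup>2 / 4 + (norm (u - v))\<^sup>2 / 4) powr \<rho>"
  using assms
  by (auto simp: rho_product_def Delta_sd_def Sigma_sd_def s_sum_def d_diff_def field_simps)

lemma rho_product_normalized:
  fixes x y :: "'a::real_normed_vector"
  assumes "x \<noteq> 0" "y \<noteq> 0"
  shows "rho_product \<rho> x y = norm x * norm y * rho_product \<rho> (x /\<^sub>R norm x) (y /\<^sub>R norm y)"
  using assms by (simp add: rho_product_def Delta_sd_def Sigma_sd_def s_sum_def d_diff_def)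

lemma has_angle_if_abs_le_one:
  assumes "-1 \<le> \<rho>" "\<rho> \<le> 1"
  shows "has_angle TYPE('a::real_normed_vector) \<rho>"
  unfolding has_angle_def
proof (intro allI)
  fix x y :: 'a
  show "\<bar>rho_product \<rho> x y\<bar> \<le> norm x * norm y"
  proof (cases "x = 0 \<or> y = 0")
    case False
    define u v where "u = x /\<^sub>R norm x" and "v = y /\<^sub>R norm y"
    have unit: "norm u = 1" "norm v = 1" using False by (auto simp: u_def v_def)
    have "\<bar>rho_product \<rho> u v\<bar> \<le> 1"
      unfolding rho_product_unit[OF unit] abs_mult
      using abs_diff_times_powr_le_one[of "(norm (u + v))\<^sup>2 / 4" "(norm (u - v))\<^sup>2 / 4" \<rho>]
        quarter_norm_sum_squared_le_one[OF unit] assms by simp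
    then show ?thesis
      using False mult_left_mono[of "\<bar>rho_product \<rho> u v\<bar>" 1 "norm x * norm y"]
      by (simp add: rho_product_normalized[of x y] u_def v_def abs_mult)
  qed (auto simp: rho_product_def)
qed

lemma has_angle_unitD:
  fixes u v :: "'a::real_normed_vector"
  assumes "has_angle TYPE('a) \<rho>" "norm u = 1" "norm v = 1"
  shows "((norm (u + v))\<^sup>2 / 4 - (norm (u - v))\<^sup>2 / 4) *
    ((norm (u + v))\<^sup>2 / 4 + (norm (u - v))\<^sup>2 / 4) powr \<rho> \<le> 1"
proof -
  have "\<bar>rho_product \<rho> u v\<bar> \<le> norm u * norm v"
    using assms(1) unfolding has_angle_def by blast
  then show ?thesis
    using rho_product_unit[OF assms(2,3), of \<rho>] assms(2,3) by simp
qed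

text \<open>Pairing the endpoint \<open>y\<close> with nearby points of the segment keeps the sum on the sphere of
  radius 2, while the difference shrinks linearly.\<close>

lemma angle_le_one_if_unit_segment:
  fixes y w :: "'a::real_normed_vector"
  assumes angle: "has_angle TYPE('a) \<rho>"
    and "w \<noteq> 0"
    and segment: "\<And>\<delta>. \<delta> \<in> {0..1} \<Longrightarrow> norm (y + \<delta> *\<^sub>R w) = 1"
  shows "\<rho> \<le> 1"
proof (rule ccontr)
  assume "\<not> \<rho> \<le> 1"
  define g where "g h = (1 - h) * (1 + h) powr \<rho>" for h :: real
  have "(g has_real_derivative (\<rho> - 1)) (at 0)"
    unfolding g_def by (auto intro!: derivative_eq_intros)
  from DERIV_pos_inc_right[OF this] \<open>\<not> \<rho> \<le> 1\<close>
  obtain \<epsilon> where "\<epsilon> > 0" and \<epsilon>: "\<And>h. 0 < h \<Longrightarrow> h < \<epsilon> \<Longrightarrow> g 0 < g h"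
    by auto
  define \<delta> where "\<delta> = min 1 (sqrt \<epsilon> / norm w)"
  have \<delta>: "0 < \<delta>" "\<delta> \<le> 1" "\<delta> * norm w \<le> sqrt \<epsilon>"
    using \<open>\<epsilon> > 0\<close> \<open>w \<noteq> 0\<close> by (auto simp: \<delta>_def min_def field_simps)
  define h where "h = (\<delta> * norm w)\<^sup>2 / 4"
  have "(\<delta> * norm w)\<^sup>2 \<le> \<epsilon>"
    using power_mono[OF \<delta>(3), of 2] \<delta>(1) \<open>\<epsilon> > 0\<close> by simp
  then have "0 < h" "h < \<epsilon>"
    using \<delta>(1) \<open>w \<noteq> 0\<close> \<open>\<epsilon> > 0\<close> by (auto simp: h_def)
  then have "1 < g h" using \<epsilon>[of h] by (simp add: g_def)
  moreover have "g h \<le> 1"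
  proof -
    have "(y + \<delta> *\<^sub>R w) + y = 2 *\<^sub>R (y + (\<delta> / 2) *\<^sub>R w)"
      by (simp add: algebra_simps scaleR_2)
    then have "norm ((y + \<delta> *\<^sub>R w) + y) = 2"
      using segment[of "\<delta> / 2"] \<delta> by simp
    moreover have "norm ((y + \<delta> *\<^sub>R w) - y) = \<delta> * norm w" using \<delta> by simp
    ultimately show ?thesis
      using has_angle_unitD[OF angle, of "y + \<delta> *\<^sub>R w" y] segment[of \<delta>] segment[of 0] \<delta>
      by (simp add: g_def h_def)
  qed
  ultimately show False by simp
qed

text \<open>Vectors at the same parameter on the two segments lie on opposite sides of the corner: their
  midpoint sinks below the sphere to first order in the parameter, while the squared norm of their
  difference is only of second order. Hence \<open>\<Sigma>/4\<close> drops below 1 about as fast as \<open>\<Delta>/4\<close>, and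
  an exponent below \<open>-1\<close> overcompensates.\<close>

lemma angle_ge_minus_one_if_corner:
  fixes x y :: "'a::real_normed_vector"
  assumes angle: "has_angle TYPE('a) \<rho>"
    and "p < q"
    and unit1: "\<And>\<delta>. \<delta> \<in> {0..1} \<Longrightarrow> norm (\<delta> *\<^sub>R x + (1 + \<delta> * p) *\<^sub>R y) = 1"
    and unit2: "\<And>\<delta>. \<delta> \<in> {0..1} \<Longrightarrow> norm (- \<delta> *\<^sub>R x + (1 - \<delta> * q) *\<^sub>R y) = 1"
  shows "-1 \<le> \<rho>"
proof (rule ccontr)
  assume "\<not> -1 \<le> \<rho>"
  define m C where "m = q - p" and "C = norm (2 *\<^sub>R x + (p + q) *\<^sub>R y)"
  define f where "f \<delta> = ((2 - \<delta> * m)\<^sup>2 / 4 - (\<delta> * C)\<^sup>2 / 4) *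
    ((2 - \<delta> * m)\<^sup>2 / 4 + (\<delta> * C)\<^sup>2 / 4) powr \<rho>" for \<delta> :: real
  have "(f has_real_derivative - m * (1 + \<rho>)) (at 0)"
    unfolding f_def by (auto intro!: derivative_eq_intros simp: field_simps)
  moreover have "0 < - m * (1 + \<rho>)"
    using \<open>p < q\<close> \<open>\<not> -1 \<le> \<rho>\<close> by (intro mult_neg_neg) (auto simp: m_def)
  ultimately obtain \<epsilon> where "\<epsilon> > 0" and \<epsilon>: "\<And>\<delta>. 0 < \<delta> \<Longrightarrow> \<delta> < \<epsilon> \<Longrightarrow> f 0 < f \<delta>"
    using DERIV_pos_inc_right by fastforce
  define \<delta> where "\<delta> = min 1 (\<epsilon> / 2)"
  have \<delta>: "0 < \<delta>" "\<delta> \<le> 1" "\<delta> < \<epsilon>" using \<open>\<epsilon> > 0\<close> by (auto simp: \<delta>_def)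
  define u v where "u = \<delta> *\<^sub>R x + (1 + \<delta> * p) *\<^sub>R y" and "v = - \<delta> *\<^sub>R x + (1 - \<delta> * q) *\<^sub>R y"
  have "norm y = 1" using unit1[of 0] by simp
  have "u + v = (2 - \<delta> * m) *\<^sub>R y"
    by (simp add: u_def v_def m_def algebra_simps scaleR_2)
  then have sum: "(norm (u + v))\<^sup>2 = (2 - \<delta> * m)\<^sup>2"
    using \<open>norm y = 1\<close> by simp
  have "u - v = \<delta> *\<^sub>R (2 *\<^sub>R x + (p + q) *\<^sub>R y)"
    by (simp add: u_def v_def algebra_simps scaleR_2)
  then have diff: "norm (u - v) = \<delta> * C"
    using \<delta> by (simp add: C_def)
  have "f \<delta> \<le> 1"
    using has_angle_unitD[OF angle, of u v] unit1[of \<delta>] unit2[of \<delta>] \<delta>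
    unfolding sum diff f_def by (simp add: u_def v_def)
  then show False using \<epsilon>[of \<delta>] \<delta> by (simp add: f_def)
qed

lemma has_angle_iff_if_convex_corner:
  fixes y :: "'a::real_normed_vector"
  assumes "convex_corner y"
  shows "has_angle TYPE('a) \<rho> \<longleftrightarrow> -1 \<le> \<rho> \<and> \<rho> \<le> 1"
proof
  assume angle: "has_angle TYPE('a) \<rho>"
  from assms obtain x p q where "p < q"
    and unit1: "\<And>\<delta>. \<delta> \<in> {0..1} \<Longrightarrow> norm (\<delta> *\<^sub>R x + (1 + \<delta> * p) *\<^sub>R y) = 1"
    and unit2: "\<And>\<delta>. \<delta> \<in> {0..1} \<Longrightarrow> norm (- \<delta> *\<^sub>R x + (1 - \<delta> * q) *\<^sub>R y) = 1"
    unfolding convex_corner_def by blast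
  have "norm y = 1" using unit1[of 0] by simp
  \<comment> \<open>If the first segment were a point, the second would run along the line through \<open>y\<close>
    and leave the unit sphere.\<close>
  have "x + p *\<^sub>R y \<noteq> 0"
  proof
    assume "x + p *\<^sub>R y = 0"
    then have x: "x = - p *\<^sub>R y" by (simp add: eq_neg_iff_add_eq_0)
    have on_line: "\<bar>1 - \<delta> * (q - p)\<bar> = 1" if "\<delta> \<in> {0..1}" for \<delta>
    proof -
      have "- \<delta> *\<^sub>R x + (1 - \<delta> * q) *\<^sub>R y = (1 - \<delta> * (q - p)) *\<^sub>R y"
        unfolding x by (simp add: algebra_simps)
      with unit2[OF that] \<open>norm y = 1\<close> show ?thesis by simp
    qed
    \<comment> \<open>A single parameter would allow a jump to \<open>-y\<close>; two of them do not.\<close>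
    from on_line[of 1] on_line[of "1/2"] \<open>p < q\<close> show False by simp
  qed
  moreover have "norm (y + \<delta> *\<^sub>R (x + p *\<^sub>R y)) = 1" if "\<delta> \<in> {0..1}" for \<delta>
    using unit1[OF that] by (simp add: algebra_simps)
  ultimately have "\<rho> \<le> 1" using angle_le_one_if_unit_segment[OF angle] by blast
  moreover have "-1 \<le> \<rho>"
    by (rule angle_ge_minus_one_if_corner[OF angle \<open>p < q\<close> unit1 unit2])
  ultimately show "-1 \<le> \<rho> \<and> \<rho> \<le> 1" by simp
qed (simp add: has_angle_if_abs_le_one)

theorem corollary3:
  assumes "\<exists>y :: 'a::real_normed_vector. convex_corner y"
  shows "Upsilon TYPE('a) = (-1, 1)"
proof -
  from assms obtain y :: 'a where "convex_corner y" ..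
  then have angles: "{\<kappa>. has_angle TYPE('a) \<kappa>} = {-1..1}"
    by (auto simp: has_angle_iff_if_convex_corner[of y])
  have "Inf (ereal ` {-1..1}) = ereal (-1)"
    by (rule Inf_eqI) auto
  moreover have "Sup (ereal ` {-1..1}) = ereal 1"
    by (rule Sup_eqI) auto
  ultimately show ?thesis
    by (simp add: Upsilon_def angles one_ereal_def)
qed

end
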